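(* Let $V=(V_1,\ldots,V_K)$, $K\geq 1$, be a discrete random vector, where each $V_k$ takes values in a finite set of levels $\{v_{k1},\ldots,v_{km_k}\}$, whose distribution is defined by stacking weights computed from the data ${\mathcal{D}}_n$. Let $Y_{n+1}$ be a real-valued future outcome with finite second moment under the resulting stacking predictive distribution, and let $\mathrm{Var}(Y_{n+1})({\mathcal{D}}_n,{\mathcal{V}}^{K})$ denote the variance of $Y_{n+1}$ under that distribution (the stacking predictive variance). Then the following two expressions hold. (i) For $K=1$, $$\mathrm{Var}(Y_{n+1})({\mathcal{D}}_n,{\mathcal{V}}^{1}) = E_{V_1}(\mathrm{Var}(Y_{n+1}\mid V_1))({\mathcal{D}}_n)+\mathrm{Var}_{V_1}E(Y_{n+1}\mid V_1)({\mathcal{D}}_n),$$ and for $K\geq 2$, $$\mathrm{Var}(Y_{n+1})({\mathcal{D}}_n,{\mathcal{V}}^{K}) = E_{(V_1,\ldots,V_K)}\mathrm{Var}(Y_{n+1}\mid V_1,\ldots,V_K)({\mathcal{D}}_n)+\sum_{k=2}^{K}E_{(V_1,\ldots,V_{k-1})}\mathrm{Var}_{V_k}E(Y_{n+1}\mid V_1,\ldots,V_k)({\mathcal{D}}_n)+\mathrm{Var}_{V_1}E(Y_{n+1}\mid V_1)({\mathcal{D}}_n).$$ (ii) For any $K\geq 1$, $$\mathrm{Var}(Y_{n+1})({\mathcal{D}}_n,{\mathcal{V}}^{K}) = E_{(V_1,\ldots,V_K)}\mathrm{Var}(Y_{n+1}\mid V_1,\ldots,V_K)({\mathcal{D}}_n)+\mathrm{Var}_{(V_1,\ldots,V_K)}E(Y_{n+1}\mid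 V_1,\ldots,V_K)({\mathcal{D}}_n).$$
   Context: ${\mathcal{D}}_n$ denotes the observed data and $Y_{n+1}$ the next (future) response. The vector $V=(V_1,\ldots,V_K)$ represents $K$ modeling choices ("factors") needed to specify a predictor; the levels of $V_k$ are $v_{k1},\ldots,v_{km_k}$, and the components need not be independent. The model list is ${\mathcal{V}}^{K}=\{v_{11},\ldots,v_{1m_1}\}\cup\cdots\cup\{v_{K1},\ldots,v_{Km_K}\}$. Stacking is a frequentist model-averaging procedure: from the data one computes weights $w(v)=w(v)({\mathcal{D}}_n)\geq 0$ with $\sum_v w(v)=1$, indexed by the possible values $v=(v_1,\ldots,v_K)$ of $V$; these define the probability mass function of $V$. For each $v$ there is a predictive distribution $p(\cdot\mid v)({\mathcal{D}}_n)$ for $Y_{n+1}$, which is the conditional law of $Y_{n+1}$ given $V=v$. The stacking predictive distribution of $Y_{n+1}$ is the mixture $\sum_v w(v)\,p(\cdot\mid v)({\mathcal{D}}_n)$. The argument $({\mathcal{D}}_n)$ indicates that quantities are functions of the data (through the weights and the fitted predictive distributions) rather than being conditional on it. $E_{(V_1,\ldots,V_k)}$ is the expectation over the marginal distribution of $(V_1,\ldots,V_k)$ under the stacking weights; $\mathrm{Var}_{V_1}$ and $\mathrm{Var}_{(V_1,\ldots,V_K)}$ are variances over the distributions of $V_1$ and $(V_1,\ldots,V_K)$ under the stacking weights; for $k\geq 2$, inside $E_{(V_1,\ldots,V_{k-1})}$, $\mathrm{Var}_{V_k}$ is the variance over the conditional distribution of $V_k$ given $V_1,\ldots,V_{k-1}$.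 *)

theory Defs
  imports "HOL-Probability.Probability"
begin

text \<open>
  The factors are indexed by \<open>1, \<dots>, K\<close> and \<open>L k\<close> is the set of levels of factor \<open>k\<close>.  A value
  \<open>v = (v\<^sub>1, \<dots>, v\<^sub>K)\<close> of \<open>V\<close> is an element of the dependent product \<open>\<Pi>\<^sub>E k\<in>{1..K}. L k\<close>, and
  \<open>restrict v {1..k}\<close> is its prefix \<open>(v\<^sub>1, \<dots>, v\<^sub>k)\<close>.  The weights \<open>w\<close> and the predictive
  distributions \<open>p\<close> are functions of the data; all quantities below take the observed data \<open>D\<close> as
  their last argument before any further variables.
\<close>

definition models :: "nat \<Rightarrow> (nat \<Rightarrow> 'v set) \<Rightarrow> (nat \<Rightarrow> 'v) set" where
  "models K L = (\<Pi>\<^sub>E k\<in>{1..K}. L k)"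

definition stacking_weights ::
  "nat \<Rightarrow> (nat \<Rightarrow> 'v set) \<Rightarrow> ('d \<Rightarrow> (nat \<Rightarrow> 'v) \<Rightarrow> real) \<Rightarrow> 'd \<Rightarrow> bool" where
  "stacking_weights K L w D \<longleftrightarrow>
     (\<forall>v\<in>models K L. w D v \<ge> 0) \<and> (\<Sum>v\<in>models K L. w D v) = 1"

definition V_pmf ::
  "nat \<Rightarrow> (nat \<Rightarrow> 'v set) \<Rightarrow> ('d \<Rightarrow> (nat \<Rightarrow> 'v) \<Rightarrow> real) \<Rightarrow> 'd \<Rightarrow> (nat \<Rightarrow> 'v) pmf" where
  "V_pmf K L w D = embed_pmf (\<lambda>v. if v \<in> models K L then w D v else 0)"

text \<open>Law of \<open>(V\<^sub>1, \<dots>, V\<^sub>k)\<close>.\<close>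

definition V_marginal ::
  "nat \<Rightarrow> (nat \<Rightarrow> 'v set) \<Rightarrow> ('d \<Rightarrow> (nat \<Rightarrow> 'v) \<Rightarrow> real) \<Rightarrow> 'd \<Rightarrow> nat \<Rightarrow> (nat \<Rightarrow> 'v) pmf" where
  "V_marginal K L w D k = map_pmf (\<lambda>v. restrict v {1..k}) (V_pmf K L w D)"

text \<open>
  Law of \<open>V\<^sub>k\<close> given \<open>(V\<^sub>1, \<dots>, V\<^sub>k\<^sub>-\<^sub>1) = u\<close>.  It is meaningful only if \<open>u\<close> has positive probability,
  and it is only ever averaged over the law of \<open>(V\<^sub>1, \<dots>, V\<^sub>k\<^sub>-\<^sub>1)\<close>.
\<close>

definition V_conditional ::
  "nat \<Rightarrow> (nat \<Rightarrow> 'v set) \<Rightarrow> ('d \<Rightarrow> (nat \<Rightarrow> 'v) \<Rightarrow> real) \<Rightarrow> 'd \<Rightarrow> nat \<Rightarrow> (nat \<Rightarrow> 'v) \<Rightarrow> 'v pmf" where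
  "V_conditional K L w D k u =
     map_pmf (\<lambda>v. v k) (cond_pmf (V_pmf K L w D) {v. restrict v {1..k-1} = u})"

text \<open>The mixture \<open>\<Sum>\<^sub>v w(v) p(\<cdot> | v)\<close>.\<close>

definition stacking_predictive ::
  "nat \<Rightarrow> (nat \<Rightarrow> 'v set) \<Rightarrow> ('d \<Rightarrow> (nat \<Rightarrow> 'v) \<Rightarrow> real) \<Rightarrow> ('d \<Rightarrow> (nat \<Rightarrow> 'v) \<Rightarrow> real measure) \<Rightarrow> 'd
     \<Rightarrow> real measure" where
  "stacking_predictive K L w p D =
     measure_of UNIV (sets borel) (\<lambda>A. \<Sum>v\<in>models K L. ennreal (w D v) * emeasure (p D v) A)"

text \<open>
  The joint law of \<open>(V, Y)\<close>, determined by \<open>V\<close> having mass function \<open>w\<close> and \<open>Y\<close> having law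
  \<open>p(\<cdot> | v)\<close> given \<open>V = v\<close>; see \<open>Y_conditional_full\<close> below.
\<close>

definition stacking_joint ::
  "nat \<Rightarrow> (nat \<Rightarrow> 'v set) \<Rightarrow> ('d \<Rightarrow> (nat \<Rightarrow> 'v) \<Rightarrow> real) \<Rightarrow> ('d \<Rightarrow> (nat \<Rightarrow> 'v) \<Rightarrow> real measure) \<Rightarrow> 'd
     \<Rightarrow> ((nat \<Rightarrow> 'v) \<times> real) measure" where
  "stacking_joint K L w p D =
     measure_of (models K L \<times> UNIV) (sets (count_space (models K L) \<Otimes>\<^sub>M borel))
       (\<lambda>A. \<Sum>v\<in>models K L. ennreal (w D v) * emeasure (p D v) (Pair v -` A))"

text \<open>
  Law of \<open>Y\<close> given \<open>(V\<^sub>1, \<dots>, V\<^sub>k) = u\<close>, by conditioning the joint law on that event.  For \<open>u\<close> of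
  probability zero it is not a probability measure; such \<open>u\<close> do not contribute to any expectation or
  variance below.
\<close>

definition Y_conditional ::
  "nat \<Rightarrow> (nat \<Rightarrow> 'v set) \<Rightarrow> ('d \<Rightarrow> (nat \<Rightarrow> 'v) \<Rightarrow> real) \<Rightarrow> ('d \<Rightarrow> (nat \<Rightarrow> 'v) \<Rightarrow> real measure) \<Rightarrow> 'd
     \<Rightarrow> nat \<Rightarrow> (nat \<Rightarrow> 'v) \<Rightarrow> real measure" where
  "Y_conditional K L w p D k u =
     distr (uniform_measure (stacking_joint K L w p D)
              {x \<in> space (stacking_joint K L w p D). restrict (fst x) {1..k} = u})
           borel snd"

definition stacking_variance ::
  "nat \<Rightarrow> (nat \<Rightarrow> 'v set) \<Rightarrow> ('d \<Rightarrow> (nat \<Rightarrow> 'v) \<Rightarrow> real) \<Rightarrow> ('d \<Rightarrow> (nat \<Rightarrow> 'v) \<Rightarrow> real measure) \<Rightarrow> 'd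
     \<Rightarrow> real" where
  "stacking_variance K L w p D = prob_space.variance (stacking_predictive K L w p D) (\<lambda>y. y)"

text \<open>\<open>E(Y | V\<^sub>1, \<dots>, V\<^sub>k)\<close> and \<open>Var(Y | V\<^sub>1, \<dots>, V\<^sub>k)\<close> as functions of the value of \<open>(V\<^sub>1, \<dots>, V\<^sub>k)\<close>.\<close>

definition cond_mean ::
  "nat \<Rightarrow> (nat \<Rightarrow> 'v set) \<Rightarrow> ('d \<Rightarrow> (nat \<Rightarrow> 'v) \<Rightarrow> real) \<Rightarrow> ('d \<Rightarrow> (nat \<Rightarrow> 'v) \<Rightarrow> real measure) \<Rightarrow> 'd
     \<Rightarrow> nat \<Rightarrow> (nat \<Rightarrow> 'v) \<Rightarrow> real" where
  "cond_mean K L w p D k u = prob_space.expectation (Y_conditional K L w p D k u) (\<lambda>y. y)"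

definition cond_var ::
  "nat \<Rightarrow> (nat \<Rightarrow> 'v set) \<Rightarrow> ('d \<Rightarrow> (nat \<Rightarrow> 'v) \<Rightarrow> real) \<Rightarrow> ('d \<Rightarrow> (nat \<Rightarrow> 'v) \<Rightarrow> real measure) \<Rightarrow> 'd
     \<Rightarrow> nat \<Rightarrow> (nat \<Rightarrow> 'v) \<Rightarrow> real" where
  "cond_var K L w p D k u = prob_space.variance (Y_conditional K L w p D k u) (\<lambda>y. y)"

text \<open>\<open>E\<^bsub>(V\<^sub>1, \<dots>, V\<^sub>k)\<^esub> Var(Y | V\<^sub>1, \<dots>, V\<^sub>k)\<close>\<close>

definition mean_cond_var ::
  "nat \<Rightarrow> (nat \<Rightarrow> 'v set) \<Rightarrow> ('d \<Rightarrow> (nat \<Rightarrow> 'v) \<Rightarrow> real) \<Rightarrow> ('d \<Rightarrow> (nat \<Rightarrow> 'v) \<Rightarrow> real measure) \<Rightarrow> 'd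
     \<Rightarrow> nat \<Rightarrow> real" where
  "mean_cond_var K L w p D k =
     measure_pmf.expectation (V_marginal K L w D k) (cond_var K L w p D k)"

text \<open>\<open>Var\<^bsub>(V\<^sub>1, \<dots>, V\<^sub>k)\<^esub> E(Y | V\<^sub>1, \<dots>, V\<^sub>k)\<close>\<close>

definition var_cond_mean ::
  "nat \<Rightarrow> (nat \<Rightarrow> 'v set) \<Rightarrow> ('d \<Rightarrow> (nat \<Rightarrow> 'v) \<Rightarrow> real) \<Rightarrow> ('d \<Rightarrow> (nat \<Rightarrow> 'v) \<Rightarrow> real measure) \<Rightarrow> 'd
     \<Rightarrow> nat \<Rightarrow> real" where
  "var_cond_mean K L w p D k =
     measure_pmf.variance (V_marginal K L w D k) (cond_mean K L w p D k)"

text \<open>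
  \<open>E\<^bsub>(V\<^sub>1, \<dots>, V\<^sub>k\<^sub>-\<^sub>1)\<^esub> Var\<^bsub>V\<^sub>k\<^esub> E(Y | V\<^sub>1, \<dots>, V\<^sub>k)\<close>: if \<open>u\<close> is the value of \<open>(V\<^sub>1, \<dots>, V\<^sub>k\<^sub>-\<^sub>1)\<close> and \<open>x\<close> that
  of \<open>V\<^sub>k\<close>, then \<open>u(k := x)\<close> is the value of \<open>(V\<^sub>1, \<dots>, V\<^sub>k)\<close>.
\<close>

definition mean_var_cond_mean ::
  "nat \<Rightarrow> (nat \<Rightarrow> 'v set) \<Rightarrow> ('d \<Rightarrow> (nat \<Rightarrow> 'v) \<Rightarrow> real) \<Rightarrow> ('d \<Rightarrow> (nat \<Rightarrow> 'v) \<Rightarrow> real measure) \<Rightarrow> 'd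
     \<Rightarrow> nat \<Rightarrow> real" where
  "mean_var_cond_mean K L w p D k =
     measure_pmf.expectation (V_marginal K L w D (k - 1))
       (\<lambda>u. measure_pmf.variance (V_conditional K L w D k u)
              (\<lambda>x. cond_mean K L w p D k (u(k := x))))"


text \<open>Consistency of the measures above.\<close>

lemma finite_models: "(\<And>k. k \<in> {1..K} \<Longrightarrow> finite (L k)) \<Longrightarrow> finite (models K L)"
  unfolding models_def by (intro finite_PiE) auto

lemma sets_stacking_joint [simp]:
  "sets (stacking_joint K L w p D) = sets (count_space (models K L) \<Otimes>\<^sub>M borel)"
  unfolding stacking_joint_def
  using sets.sets_measure_of_eq[of "count_space (models K L) \<Otimes>\<^sub>M (borel :: real measure)"]
  by (simp add: space_pair_measure)

lemma space_stacking_joint [simp]: "space (stacking_joint K L w p D) = models K L \<times> UNIV"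
  by (simp add: stacking_joint_def space_measure_of_conv)

lemma sets_stacking_predictive [simp]: "sets (stacking_predictive K L w p D) = sets borel"
  unfolding stacking_predictive_def 
  using sets.sets_measure_of_eq[of "borel :: real measure"] by simp

lemma emeasure_stacking_predictive:
  assumes "\<forall>v\<in>models K L. real_distribution (p D v)" and A: "A \<in> sets borel"
  shows "emeasure (stacking_predictive K L w p D) A =
           (\<Sum>v\<in>models K L. ennreal (w D v) * emeasure (p D v) A)"
proof (rule emeasure_measure_of[OF stacking_predictive_def])
  have S: "sets (p D v) = sets borel" if "v \<in> models K L" for v
    using assms that by (simp add: real_distribution.events_eq_borel)
  show "countably_additive (sets (stacking_predictive K L w p D))
          (\<lambda>A. \<Sum>v\<in>models K L. ennreal (w D v) * emeasure (p D v) A)"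
    unfolding countably_additive_def
  proof (intro allI impI)
    fix B :: "nat \<Rightarrow> real set"
    assume B: "range B \<subseteq> sets (stacking_predictive K L w p D)" "disjoint_family B"
    have "(\<Sum>i. emeasure (p D v) (B i)) = emeasure (p D v) (\<Union> (range B))"
      if "v \<in> models K L" for v
      by (rule suminf_emeasure) (use B S[OF that] in auto)
    note additive = this
    have "(\<Sum>i. \<Sum>v\<in>models K L. ennreal (w D v) * emeasure (p D v) (B i)) =
        (\<Sum>v\<in>models K L. \<Sum>i. ennreal (w D v) * emeasure (p D v) (B i))"
      by (rule suminf_sum) (rule summableI)
    also have "\<dots> = (\<Sum>v\<in>models K L. ennreal (w D v) * emeasure (p D v) (\<Union> (range B)))"
      by (intro sum.cong refl) (simp add: ennreal_suminf_cmult additive)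
    finally show "(\<Sum>i. \<Sum>v\<in>models K L. ennreal (w D v) * emeasure (p D v) (B i)) =
        (\<Sum>v\<in>models K L. ennreal (w D v) * emeasure (p D v) (\<Union> (range B)))" .
  qed
qed (use A in \<open>simp_all add: positive_def\<close>)

lemma emeasure_stacking_joint:
  assumes "\<forall>v\<in>models K L. real_distribution (p D v)"
    and A: "A \<in> sets (count_space (models K L) \<Otimes>\<^sub>M borel)"
  shows "emeasure (stacking_joint K L w p D) A =
           (\<Sum>v\<in>models K L. ennreal (w D v) * emeasure (p D v) (Pair v -` A))"
proof (rule emeasure_measure_of[OF stacking_joint_def])
  have S: "sets (p D v) = sets borel" if "v \<in> models K L" for v
    using assms that by (simp add: real_distribution.events_eq_borel)
  show "sets (count_space (models K L) \<Otimes>\<^sub>M borel) \<subseteq> Pow (models K L \<times> (UNIV :: real set))"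
    using sets.space_closed[of "count_space (models K L) \<Otimes>\<^sub>M (borel :: real measure)"]
    by (simp add: space_pair_measure)
  show "countably_additive (sets (stacking_joint K L w p D))
          (\<lambda>A. \<Sum>v\<in>models K L. ennreal (w D v) * emeasure (p D v) (Pair v -` A))"
    unfolding countably_additive_def
  proof (intro allI impI)
    fix B :: "nat \<Rightarrow> (_ \<times> real) set"
    assume B: "range B \<subseteq> sets (stacking_joint K L w p D)" "disjoint_family B"
    have "(\<Sum>i. emeasure (p D v) (Pair v -` B i)) = emeasure (p D v) (Pair v -` \<Union> (range B))"
      if "v \<in> models K L" for v
    proof -
      have "Pair v -` B i \<in> sets borel" for i
        by (rule sets_Pair1[of _ "count_space (models K L)"]) (use B in auto)
      moreover have "disjoint_family (\<lambda>i. Pair v -` B i)"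
        using B(2) by (auto simp: disjoint_family_on_def)
      ultimately have "(\<Sum>i. emeasure (p D v) (Pair v -` B i)) =
          emeasure (p D v) (\<Union>i. Pair v -` B i)"
        using S[OF that] by (intro suminf_emeasure) auto
      then show ?thesis by (simp add: vimage_UN)
    qed
    note additive = this
    have "(\<Sum>i. \<Sum>v\<in>models K L. ennreal (w D v) * emeasure (p D v) (Pair v -` B i)) =
        (\<Sum>v\<in>models K L. \<Sum>i. ennreal (w D v) * emeasure (p D v) (Pair v -` B i))"
      by (rule suminf_sum) (rule summableI)
    also have "\<dots> = (\<Sum>v\<in>models K L. ennreal (w D v) * emeasure (p D v) (Pair v -` \<Union> (range B)))"
      by (intro sum.cong refl) (simp add: ennreal_suminf_cmult additive)
    finally show "(\<Sum>i. \<Sum>v\<in>models K L. ennreal (w D v) * emeasure (p D v) (Pair v -` B i)) =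
        (\<Sum>v\<in>models K L. ennreal (w D v) * emeasure (p D v) (Pair v -` \<Union> (range B)))" .
  qed
qed (use A in \<open>simp_all add: positive_def\<close>)

lemma pmf_V_pmf:
  assumes "\<forall>k\<in>{1..K}. finite (L k)" "stacking_weights K L w D"
  shows "pmf (V_pmf K L w D) v = (if v \<in> models K L then w D v else 0)"
  unfolding V_pmf_def
proof (rule pmf_embed_pmf)
  have fin: "finite (models K L)" using assms(1) by (intro finite_models) auto
  have "(\<integral>\<^sup>+ v. ennreal (if v \<in> models K L then w D v else 0) \<partial>count_space UNIV)
      = (\<Sum>v\<in>models K L. ennreal (w D v))"
    by (subst nn_integral_count_space'[OF fin]) auto
  also have "\<dots> = ennreal (\<Sum>v\<in>models K L. w D v)"
    using assms(2) by (intro sum_ennreal) (auto simp: stacking_weights_def)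
  finally show "(\<integral>\<^sup>+ v. ennreal (if v \<in> models K L then w D v else 0) \<partial>count_space UNIV) = 1"
    using assms(2) by (simp add: stacking_weights_def)
qed (use assms(2) in \<open>auto simp: stacking_weights_def\<close>)

lemma stacking_predictive_eq_marginal:
  assumes "\<forall>v\<in>models K L. real_distribution (p D v)"
  shows "stacking_predictive K L w p D = distr (stacking_joint K L w p D) borel snd"
proof (rule measure_eqI)
  fix A assume "A \<in> sets (stacking_predictive K L w p D)"
  then have A: "A \<in> sets borel" by simp
  have eq: "snd -` A \<inter> models K L \<times> UNIV = models K L \<times> A" by auto
  have "snd \<in> stacking_joint K L w p D \<rightarrow>\<^sub>M borel"
    by (subst measurable_cong_sets[OF sets_stacking_joint refl]) simp
  then have "emeasure (distr (stacking_joint K L w p D) borel snd) A =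
      emeasure (stacking_joint K L w p D) (models K L \<times> A)"
    using A eq by (simp add: emeasure_distr)
  also have "\<dots> = (\<Sum>v\<in>models K L. ennreal (w D v) * emeasure (p D v) A)"
  proof -
    have "models K L \<times> A \<in> sets (count_space (models K L) \<Otimes>\<^sub>M borel)"
      using A by (intro pair_measureI) auto
    moreover have "Pair v -` (models K L \<times> A) = A" if "v \<in> models K L" for v
      using that by auto
    ultimately show ?thesis
      using assms by (simp add: emeasure_stacking_joint)
  qed
  finally show "emeasure (stacking_predictive K L w p D) A =
      emeasure (distr (stacking_joint K L w p D) borel snd) A"
    using assms A by (simp add: emeasure_stacking_predictive)
qed simp

text \<open>\<open>p(\<cdot> | v)\<close> is the conditional law of \<open>Y\<close> given \<open>V = v\<close>.\<close>

lemma Y_conditional_full: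
  assumes fin: "\<forall>k\<in>{1..K}. finite (L k)" and p: "\<forall>v\<in>models K L. real_distribution (p D v)"
    and v: "v \<in> models K L" and w: "w D v > 0"
  shows "Y_conditional K L w p D K v = p D v"
proof (rule measure_eqI)
  let ?J = "stacking_joint K L w p D"
  interpret real_distribution "p D v" using p v by auto
  have "finite (models K L)" using fin by (intro finite_models) auto
  show "sets (Y_conditional K L w p D K v) = sets (p D v)"
    by (simp add: Y_conditional_def)
  fix A assume "A \<in> sets (Y_conditional K L w p D K v)"
  then have A: "A \<in> sets borel" by (simp add: Y_conditional_def)
  have restr: "restrict u {1..K} = u" if "u \<in> models K L" for u
    using that by (simp add: models_def PiE_restrict)
  have E: "{x \<in> space ?J. restrict (fst x) {1..K} = v} = {v} \<times> UNIV"
    using v restr by auto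
  have J: "emeasure ?J ({v} \<times> B) = ennreal (w D v) * emeasure (p D v) B"
    if "B \<in> sets borel" for B
  proof -
    have "{v} \<times> B \<in> sets (count_space (models K L) \<Otimes>\<^sub>M borel)"
      using v that by (intro pair_measureI) auto
    then have "emeasure ?J ({v} \<times> B) =
        (\<Sum>u\<in>models K L. ennreal (w D u) * emeasure (p D u) (Pair u -` ({v} \<times> B)))"
      using p by (simp add: emeasure_stacking_joint)
    also have "\<dots> = (\<Sum>u\<in>models K L. if u = v then ennreal (w D v) * emeasure (p D v) B else 0)"
      by (intro sum.cong) auto
    finally show ?thesis using \<open>finite (models K L)\<close> v by simp
  qed
  have eq: "snd -` A \<inter> models K L \<times> UNIV = models K L \<times> A" by auto
  have m: "snd \<in> uniform_measure ?J ({v} \<times> UNIV) \<rightarrow>\<^sub>M borel"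
    by (subst measurable_cong_sets[of _ "count_space (models K L) \<Otimes>\<^sub>M borel" _ borel]) auto
  have "emeasure (Y_conditional K L w p D K v) A =
      emeasure (uniform_measure ?J ({v} \<times> UNIV)) (models K L \<times> A)"
    unfolding Y_conditional_def E using A m eq by (simp add: emeasure_distr)
  also have "\<dots> = emeasure ?J (({v} \<times> UNIV) \<inter> (models K L \<times> A)) / emeasure ?J ({v} \<times> UNIV)"
    using v A by (intro emeasure_uniform_measure) (simp_all add: pair_measureI)
  also have "({v} \<times> UNIV) \<inter> (models K L \<times> A) = {v} \<times> A"
    using v by auto
  also have "emeasure ?J ({v} \<times> A) / emeasure ?J ({v} \<times> UNIV) = emeasure (p D v) A"
    using w A emeasure_space_1
    by (simp add: J mult.commute[of "ennreal (w D v)"] ennreal_mult_divide_eq)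
  finally show "emeasure (Y_conditional K L w p D K v) A = emeasure (p D v) A" .
qed

end

theory Submission
  imports Defs
begin

text \<open>
  Let \<open>\<mu>\<^sub>k = E(Y | V\<^sub>1, \<dots>, V\<^sub>k)\<close>.  Everything reduces to finite sums over the models.  By the tower
  property \<open>\<mu>\<^sub>k\<^sub>-\<^sub>1\<close> is the conditional mean of \<open>\<mu>\<^sub>k\<close>, so the \<open>k\<close>-th term of the sum equals
  \<open>E \<mu>\<^sub>k\<^sup>2 - E \<mu>\<^sub>k\<^sub>-\<^sub>1\<^sup>2\<close>; the sum telescopes, which deduces (i) from (ii).
\<close>

section \<open>Integrals with respect to finite mixtures\<close>

text \<open>Both sides are additive, homogeneous and continuous along increasing sequences in
  \<open>f\<close>, so induction on \<open>f\<close> reduces the identity to indicators, where it is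
  the hypothesis \<open>mixture\<close>.\<close>

lemma nn_integral_mixture:
  assumes f: "f \<in> borel_measurable M"
    and sets: "sets N = sets M" "\<And>v. v \<in> S \<Longrightarrow> sets (p v) = sets M"
    and mixture: "\<And>A. A \<in> sets M \<Longrightarrow> emeasure N A = (\<Sum>v\<in>S. ennreal (a v) * emeasure (p v) A)"
  shows "(\<integral>\<^sup>+x. f x \<partial>N) = (\<Sum>v\<in>S. ennreal (a v) * (\<integral>\<^sup>+x. f x \<partial>p v))"
  using f
proof induction
  case (cong f g)
  have "(\<integral>\<^sup>+x. f x \<partial>N) = (\<integral>\<^sup>+x. g x \<partial>N)"
    by (rule nn_integral_cong) (use cong sets_eq_imp_space_eq[OF sets(1)] in auto)
  moreover have "(\<integral>\<^sup>+x. f x \<partial>p v) = (\<integral>\<^sup>+x. g x \<partial>p v)" if "v \<in> S" for v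
    by (rule nn_integral_cong) (use cong sets_eq_imp_space_eq[OF sets(2)[OF that]] in auto)
  ultimately show ?case using cong by simp
next
  case (set A)
  then show ?case using sets by (simp add: mixture)
next
  case (mult u c)
  note [measurable_cong] = sets(1)
  have "(\<integral>\<^sup>+x. c * u x \<partial>N) = c * (\<integral>\<^sup>+x. u x \<partial>N)"
    using mult by (intro nn_integral_cmult) measurable
  moreover have "(\<integral>\<^sup>+x. c * u x \<partial>p v) = c * (\<integral>\<^sup>+x. u x \<partial>p v)" if "v \<in> S" for v
    using mult measurable_cong_sets[OF sets(2)[OF that] refl] by (intro nn_integral_cmult) blast
  ultimately show ?case using mult by (simp add: sum_distrib_left mult_ac)
next
  case (add u v)
  have "(\<integral>\<^sup>+x. v x + u x \<partial>N) = (\<integral>\<^sup>+x. v x \<partial>N) + (\<integral>\<^sup>+x. u x \<partial>N)"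
    using add measurable_cong_sets[OF sets(1) refl] by (intro nn_integral_add) blast+
  moreover have "(\<integral>\<^sup>+x. v x + u x \<partial>p i) = (\<integral>\<^sup>+x. v x \<partial>p i) + (\<integral>\<^sup>+x. u x \<partial>p i)" if "i \<in> S" for i
    using add measurable_cong_sets[OF sets(2)[OF that] refl] by (intro nn_integral_add) blast+
  ultimately show ?case using add by (simp add: distrib_left sum.distrib)
next
  case (seq U)
  have "(\<integral>\<^sup>+x. (SUP i. U i) x \<partial>N) = (SUP i. \<integral>\<^sup>+x. U i x \<partial>N)"
    unfolding SUP_apply using seq measurable_cong_sets[OF sets(1) refl]
    by (intro nn_integral_monotone_convergence_SUP) blast+
  moreover have "(\<integral>\<^sup>+x. (SUP i. U i) x \<partial>p v) = (SUP i. \<integral>\<^sup>+x. U i x \<partial>p v)" if "v \<in> S" for v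
    unfolding SUP_apply using seq measurable_cong_sets[OF sets(2)[OF that] refl]
    by (intro nn_integral_monotone_convergence_SUP) blast+
  moreover have "(\<Sum>v\<in>S. ennreal (a v) * (SUP i. \<integral>\<^sup>+x. U i x \<partial>p v)) =
      (SUP i. \<Sum>v\<in>S. ennreal (a v) * (\<integral>\<^sup>+x. U i x \<partial>p v))"
    unfolding SUP_mult_left_ennreal
  proof (rule ennreal_SUP_sum[symmetric])
    show "incseq (\<lambda>i. ennreal (a v) * (\<integral>\<^sup>+x. U i x \<partial>p v))" for v
      using \<open>incseq U\<close> by (auto simp: incseq_def le_fun_def intro!: mult_left_mono nn_integral_mono)
  qed
  ultimately show ?case using seq by simp
qed

text \<open>The nonnegative case is applied to the positive and negative parts of \<open>f\<close>.
  Integrability is asked only of components of positive weight, because a finite moment of the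
  mixture says nothing about the others.\<close>

lemma integral_mixture:
  fixes f :: "'a \<Rightarrow> real"
  assumes f: "f \<in> borel_measurable M"
    and sets: "sets N = sets M" "\<And>v. v \<in> S \<Longrightarrow> sets (p v) = sets M"
    and mixture: "\<And>A. A \<in> sets M \<Longrightarrow> emeasure N A = (\<Sum>v\<in>S. ennreal (a v) * emeasure (p v) A)"
    and a: "\<And>v. v \<in> S \<Longrightarrow> a v \<ge> 0"
    and int: "\<And>v. v \<in> S \<Longrightarrow> a v > 0 \<Longrightarrow> integrable (p v) f"
  shows "integrable N f" and "(\<integral>x. f x \<partial>N) = (\<Sum>v\<in>S. a v * (\<integral>x. f x \<partial>p v))"
proof -
  note nn = nn_integral_mixture[OF _ sets mixture]
  \<comment> \<open>The function \<open>g\<close> stands for the identity, negation and absolute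
    value at once. A component of weight zero may have an infinite integral, but
    \<open>0 * top = 0\<close> in \<open>ennreal\<close>.\<close>
  have fin: "ennreal (a v) * (\<integral>\<^sup>+x. ennreal (g (f x)) \<partial>p v) < top"
    if "v \<in> S" "\<And>y. g y \<le> \<bar>y\<bar>" for v and g :: "real \<Rightarrow> real"
  proof (cases "a v = 0")
    case False
    then have "integrable (p v) f" using a int that by force
    then have "(\<integral>\<^sup>+x. ennreal \<bar>f x\<bar> \<partial>p v) < top" by (simp add: integrable_iff_bounded)
    moreover have "(\<integral>\<^sup>+x. ennreal (g (f x)) \<partial>p v) \<le> (\<integral>\<^sup>+x. ennreal \<bar>f x\<bar> \<partial>p v)"
      using that by (intro nn_integral_mono ennreal_leI)
    ultimately show ?thesis by (auto simp: ennreal_mult_less_top)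
  qed simp
  \<comment> \<open>Passing \<open>enn2real\<close> through the sum requires every summand to be
    finite, which is what \<open>fin\<close> supplies.\<close>
  have real: "enn2real (\<integral>\<^sup>+x. ennreal (g (f x)) \<partial>N) =
      (\<Sum>v\<in>S. a v * enn2real (\<integral>\<^sup>+x. ennreal (g (f x)) \<partial>p v))"
    if "\<And>y. g y \<le> \<bar>y\<bar>" "g \<in> borel_measurable borel" for g :: "real \<Rightarrow> real"
  proof -
    have "(\<integral>\<^sup>+x. ennreal (g (f x)) \<partial>N) = (\<Sum>v\<in>S. ennreal (a v) * (\<integral>\<^sup>+x. ennreal (g (f x)) \<partial>p v))"
      by (rule nn) (use f that in measurable)
    then show ?thesis
      using fin[OF _ that(1)] a by (simp add: enn2real_sum enn2real_mult)
  qed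
  show int_N: "integrable N f"
  proof (rule integrableI_bounded)
    show "f \<in> borel_measurable N" using f measurable_cong_sets[OF sets(1) refl] by blast
    have "(\<integral>\<^sup>+x. ennreal \<bar>f x\<bar> \<partial>N) = (\<Sum>v\<in>S. ennreal (a v) * (\<integral>\<^sup>+x. ennreal \<bar>f x\<bar> \<partial>p v))"
      by (rule nn) (use f in measurable)
    also have "\<dots> < top"
      using fin[of _ abs] by (cases "finite S") auto
    finally show "(\<integral>\<^sup>+x. ennreal (norm (f x)) \<partial>N) < \<infinity>" by simp
  qed
  have "(\<integral>x. f x \<partial>N) =
      (\<Sum>v\<in>S. a v * (enn2real (\<integral>\<^sup>+x. ennreal (f x) \<partial>p v) - enn2real (\<integral>\<^sup>+x. ennreal (- f x) \<partial>p v)))"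
    using real[of "\<lambda>y. y"] real[of uminus]
    by (simp add: real_lebesgue_integral_def[OF int_N] sum_subtractf right_diff_distrib abs_ge_minus_self)
  also have "\<dots> = (\<Sum>v\<in>S. a v * (\<integral>x. f x \<partial>p v))"
  proof (intro sum.cong refl)
    fix v assume "v \<in> S"
    then show "a v * (enn2real (\<integral>\<^sup>+x. ennreal (f x) \<partial>p v) - enn2real (\<integral>\<^sup>+x. ennreal (- f x) \<partial>p v)) =
        a v * (\<integral>x. f x \<partial>p v)"
      using a[of v] int[of v] by (cases "a v = 0") (auto simp: real_lebesgue_integral_def)
  qed
  finally show "(\<integral>x. f x \<partial>N) = (\<Sum>v\<in>S. a v * (\<integral>x. f x \<partial>p v))" .
qed

section \<open>Weighted means over the fibres of a map\<close>

text \<open>The elementary conditional expectation of \<open>h\<close> given \<open>r = u\<close>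
  under the weights \<open>w\<close>. On a fibre of total weight zero, division by zero makes it
  0.\<close>

definition fibre_mean :: "('a \<Rightarrow> real) \<Rightarrow> 'a set \<Rightarrow> ('a \<Rightarrow> 'b) \<Rightarrow> ('a \<Rightarrow> real) \<Rightarrow> 'b \<Rightarrow> real" where
  "fibre_mean w M r h u = (\<Sum>v | v \<in> M \<and> r v = u. w v * h v) / (\<Sum>v | v \<in> M \<and> r v = u. w v)"

text \<open>On a fibre of total weight zero every single weight vanishes by nonnegativity, so both
  sides are 0 and the default value does no harm.\<close>

lemma fibre_mean_mult:
  assumes "finite M" "\<And>v. v \<in> M \<Longrightarrow> w v \<ge> 0"
  shows "(\<Sum>v | v \<in> M \<and> r v = u. w v) * fibre_mean w M r h u = (\<Sum>v | v \<in> M \<and> r v = u. w v * h v)"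
proof (cases "(\<Sum>v | v \<in> M \<and> r v = u. w v) = 0")
  case True
  then have "w v = 0" if "v \<in> M" "r v = u" for v
    using assms that sum_nonneg_eq_0_iff[of "{v. v \<in> M \<and> r v = u}" w] by auto
  then show ?thesis using True by simp
qed (simp add: fibre_mean_def)

text \<open>The characteristic property of conditional expectation, with \<open>g\<close> as test
  function. It is checked on each fibre of \<open>r\<close>, where \<open>g (r v)\<close> is
  constant; \<open>g = 1\<close> gives the law of total expectation.\<close>

lemma sum_fibre_mean:
  assumes "finite M" "\<And>v. v \<in> M \<Longrightarrow> w v \<ge> 0"
  shows "(\<Sum>v\<in>M. w v * (g (r v) * fibre_mean w M r h (r v))) = (\<Sum>v\<in>M. w v * (g (r v) * h v))"
proof -
  have "(\<Sum>v | v \<in> M \<and> r v = u. w v * (g (r v) * fibre_mean w M r h (r v))) =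
      (\<Sum>v | v \<in> M \<and> r v = u. w v * (g (r v) * h v))" for u
  proof -
    have "(\<Sum>v | v \<in> M \<and> r v = u. w v * (g (r v) * fibre_mean w M r h (r v))) =
        (\<Sum>v | v \<in> M \<and> r v = u. w v * fibre_mean w M r h u * g u)"
      by (rule sum.cong) auto
    also have "\<dots> = (\<Sum>v | v \<in> M \<and> r v = u. w v) * fibre_mean w M r h u * g u"
      by (simp add: sum_distrib_right)
    also have "\<dots> = (\<Sum>v | v \<in> M \<and> r v = u. w v * (g (r v) * h v))"
      by (subst fibre_mean_mult[OF assms], simp, subst sum_distrib_right, rule sum.cong) auto
    finally show ?thesis .
  qed
  then show ?thesis
    using assms(1) by (simp add: sum.image_gen[of M _ r])
qed

text \<open>The fibres of \<open>r\<close> refine those of \<open>q\<close>. A fibre of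
  \<open>r\<close> that meets \<open>?S\<close> lies inside it, so the inner mean can be computed
  within \<open>?S\<close>, and total expectation on \<open>?S\<close> matches the
  numerators.\<close>

lemma fibre_mean_tower:
  assumes fin: "finite M" and w: "\<And>v. v \<in> M \<Longrightarrow> w v \<ge> 0"
    and r: "\<And>v v'. r v = r v' \<Longrightarrow> q v = q v'"
  shows "fibre_mean w M q (\<lambda>v. fibre_mean w M r h (r v)) u = fibre_mean w M q h u"
proof -
  let ?S = "{v. v \<in> M \<and> q v = u}"
  have "fibre_mean w M r h (r v) = fibre_mean w ?S r h (r v)" if "v \<in> ?S" for v
  proof -
    have "{x. x \<in> M \<and> r x = r v} = {x. x \<in> ?S \<and> r x = r v}" using that r by blast
    then show ?thesis by (simp add: fibre_mean_def)
  qed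
  then have "(\<Sum>v\<in>?S. w v * fibre_mean w M r h (r v)) = (\<Sum>v\<in>?S. w v * (1 * fibre_mean w ?S r h (r v)))"
    by simp
  also have "\<dots> = (\<Sum>v\<in>?S. w v * (1 * h v))"
    by (rule sum_fibre_mean) (use fin w in auto)
  finally show ?thesis by (simp add: fibre_mean_def)
qed

section \<open>The stacking model\<close>

locale stacking =
  fixes K :: nat
    and L :: "nat \<Rightarrow> 'v set"
    and w :: "'d \<Rightarrow> (nat \<Rightarrow> 'v) \<Rightarrow> real"
    and p :: "'d \<Rightarrow> (nat \<Rightarrow> 'v) \<Rightarrow> real measure"
    and D :: 'd
  assumes finite_levels: "\<forall>k\<in>{1..K}. finite (L k)"
    and weights: "stacking_weights K L w D"
    and distributions: "\<forall>v\<in>models K L. real_distribution (p D v)"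
    and square_integrable: "integrable (stacking_predictive K L w p D) (\<lambda>y. y\<^sup>2)"
begin

declare One_nat_def [simp del]

abbreviation "M \<equiv> models K L"

abbreviation initial :: "nat \<Rightarrow> (nat \<Rightarrow> 'v) \<Rightarrow> nat \<Rightarrow> 'v" where
  "initial k v \<equiv> restrict v {1..k}"

text \<open>For a model of weight zero this moment, like \<open>s\<close> below, may be the default
  value of a nonexistent integral; it only ever enters multiplied by that weight.\<close>

definition m :: "(nat \<Rightarrow> 'v) \<Rightarrow> real" where "m v = (\<integral>y. y \<partial>p D v)"

definition s :: "(nat \<Rightarrow> 'v) \<Rightarrow> real" where "s v = (\<integral>y. y\<^sup>2 \<partial>p D v)"

lemma finite_M: "finite M"
  using finite_levels by (intro finite_models) auto

lemma w_nonneg: "v \<in> M \<Longrightarrow> w D v \<ge> 0" and sum_w: "(\<Sum>v\<in>M. w D v) = 1"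
  using weights by (auto simp: stacking_weights_def)

lemma initial_models: "v \<in> M \<Longrightarrow> initial K v = v"
  by (simp add: models_def PiE_restrict)

section \<open>Moments of the component distributions\<close>

lemma sets_p: "v \<in> M \<Longrightarrow> sets (p D v) = sets borel"
  using distributions by (simp add: real_distribution.events_eq_borel)

text \<open>The second moment of the mixture is the weighted sum of the component second moments. It
  is finite, hence so is every term with positive weight.\<close>

lemma square_integrable_p:
  assumes v: "v \<in> M" and pos: "w D v > 0"
  shows "integrable (p D v) (\<lambda>y. y\<^sup>2)"
proof (rule integrableI_bounded)
  have "(\<integral>\<^sup>+y. ennreal (y\<^sup>2) \<partial>stacking_predictive K L w p D) =
      (\<Sum>v\<in>M. ennreal (w D v) * (\<integral>\<^sup>+y. ennreal (y\<^sup>2) \<partial>p D v))"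
    by (rule nn_integral_mixture[where M = borel])
      (use distributions in \<open>simp_all add: sets_p emeasure_stacking_predictive\<close>)
  moreover have "(\<integral>\<^sup>+y. ennreal (y\<^sup>2) \<partial>stacking_predictive K L w p D) < top"
    using square_integrable by (simp add: integrable_iff_bounded)
  ultimately have "ennreal (w D v) * (\<integral>\<^sup>+y. ennreal (y\<^sup>2) \<partial>p D v) < top"
    using v finite_M by simp
  then show "(\<integral>\<^sup>+y. ennreal (norm (y\<^sup>2)) \<partial>p D v) < \<infinity>"
    using pos by (auto simp: ennreal_mult_less_top)
  show "(\<lambda>y. y\<^sup>2) \<in> borel_measurable (p D v)"
    by (subst measurable_cong_sets[OF sets_p[OF v] refl]) measurable
qed

lemma integrable_p:
  assumes v: "v \<in> M" and pos: "w D v > 0"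
  shows "integrable (p D v) (\<lambda>y. y)"
proof -
  interpret real_distribution "p D v" using distributions v by blast
  show ?thesis
    by (rule square_integrable_imp_integrable[OF _ square_integrable_p[OF assms]]) measurable
qed

section \<open>The law of Y given a prefix of V\<close>

lemma sets_Y_conditional [simp]: "sets (Y_conditional K L w p D k u) = sets borel"
  by (simp add: Y_conditional_def)

text \<open>Conditioning on a prefix again yields a finite mixture: the components are the models
  extending \<open>u\<close>, with their weights renormalised. This form makes
  \<open>integral_mixture\<close> applicable to conditional means.\<close>

lemma emeasure_Y_conditional:
  assumes pos: "(\<Sum>v | v \<in> M \<and> initial k v = u. w D v) > 0" and A: "A \<in> sets borel"
  shows "emeasure (Y_conditional K L w p D k u) A =
    (\<Sum>v | v \<in> M \<and> initial k v = u.
       ennreal (w D v / (\<Sum>v | v \<in> M \<and> initial k v = u. w D v)) * emeasure (p D v) A)"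
proof -
  let ?J = "stacking_joint K L w p D"
  let ?S = "{v. v \<in> M \<and> initial k v = u}"
  let ?W = "\<Sum>v\<in>?S. w D v"
  have E: "{x \<in> space ?J. restrict (fst x) {1..k} = u} = ?S \<times> UNIV" by auto
  have meas: "?S \<times> B \<in> sets (count_space M \<Otimes>\<^sub>M borel)" if "B \<in> sets borel" for B :: "real set"
    using that by (intro pair_measureI) auto
  have J: "emeasure ?J (?S \<times> B) = (\<Sum>v\<in>?S. ennreal (w D v) * emeasure (p D v) B)"
    if "B \<in> sets borel" for B
  proof -
    have "emeasure ?J (?S \<times> B) =
        (\<Sum>v\<in>M. ennreal (w D v) * emeasure (p D v) (Pair v -` (?S \<times> B)))"
      using distributions meas[OF that] by (rule emeasure_stacking_joint)
    \<comment> \<open>The slice of the rectangle at \<open>v\<close> is \<open>B\<close> for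
      \<open>v\<close> in \<open>?S\<close> and empty otherwise.\<close>
    also have "\<dots> = (\<Sum>v\<in>?S. ennreal (w D v) * emeasure (p D v) B)"
      using finite_M by (intro sum.mono_neutral_cong_right) auto
    finally show ?thesis .
  qed
  have JU: "emeasure ?J (?S \<times> UNIV) = ennreal ?W"
  proof -
    have "emeasure (p D v) UNIV = 1" if "v \<in> M" for v
    proof -
      interpret real_distribution "p D v" using distributions that by blast
      show ?thesis using emeasure_space_1 by simp
    qed
    then have "emeasure ?J (?S \<times> UNIV) = (\<Sum>v\<in>?S. ennreal (w D v))" by (simp add: J)
    also have "\<dots> = ennreal ?W" using w_nonneg by (intro sum_ennreal) blast
    finally show ?thesis .
  qed
  have eq: "snd -` A \<inter> M \<times> UNIV = M \<times> A" by auto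
  have meas_snd: "snd \<in> uniform_measure ?J (?S \<times> UNIV) \<rightarrow>\<^sub>M borel"
    by (subst measurable_cong_sets[of _ "count_space M \<Otimes>\<^sub>M borel" _ borel]) auto
  have "emeasure (Y_conditional K L w p D k u) A =
      emeasure (uniform_measure ?J (?S \<times> UNIV)) (M \<times> A)"
    unfolding Y_conditional_def E using A meas_snd eq by (simp add: emeasure_distr)
  also have "\<dots> = emeasure ?J ((?S \<times> UNIV) \<inter> (M \<times> A)) / emeasure ?J (?S \<times> UNIV)"
    using A meas[of UNIV] by (intro emeasure_uniform_measure) (simp_all add: pair_measureI)
  also have "(?S \<times> UNIV) \<inter> (M \<times> A) = ?S \<times> A" by auto
  also have "emeasure ?J (?S \<times> A) / emeasure ?J (?S \<times> UNIV) =
      (\<Sum>v\<in>?S. ennreal (w D v) * emeasure (p D v) A) / ennreal ?W"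
    using A by (simp only: J JU)
  also have "\<dots> = (\<Sum>v\<in>?S. ennreal (w D v / ?W) * emeasure (p D v) A)"
    unfolding divide_ennreal_def sum_distrib_right
  proof (intro sum.cong refl)
    fix v assume "v \<in> ?S"
    then have "ennreal (w D v / ?W) = ennreal (w D v) * inverse (ennreal ?W)"
      using pos w_nonneg[of v] by (simp add: divide_ennreal[symmetric] divide_ennreal_def)
    then show "ennreal (w D v) * emeasure (p D v) A * inverse (ennreal ?W) =
        ennreal (w D v / ?W) * emeasure (p D v) A"
      by (simp add: mult_ac)
  qed
  finally show ?thesis .
qed

text \<open>Every prefix of a model of positive weight has positive probability. Fixing such a model
  is how the lemmas below avoid conditioning on null events.\<close>

lemma fibre_weight_pos:
  assumes "v \<in> M" "w D v > 0"
  shows "(\<Sum>v' | v' \<in> M \<and> initial k v' = initial k v. w D v') > 0"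
  using assms finite_M by (intro sum_pos2[of _ v]) (auto intro: w_nonneg)

lemma cond_mean_eq:
  assumes "v \<in> M" "w D v > 0"
  shows "cond_mean K L w p D k (initial k v) = fibre_mean (w D) M (initial k) m (initial k v)"
proof -
  let ?S = "{v'. v' \<in> M \<and> initial k v' = initial k v}"
  let ?W = "\<Sum>v'\<in>?S. w D v'"
  note pos = fibre_weight_pos[OF assms, of k]
  have "cond_mean K L w p D k (initial k v) = (\<Sum>v'\<in>?S. w D v' / ?W * (\<integral>y. y \<partial>p D v'))"
    unfolding cond_mean_def
    by (rule integral_mixture(2)[where M = borel])
      (use pos in \<open>auto simp: sets_p w_nonneg emeasure_Y_conditional
        zero_less_divide_iff intro!: integrable_p\<close>)
  then show ?thesis by (simp add: fibre_mean_def m_def sum_divide_distrib)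
qed

text \<open>The full prefix determines the model, so the conditional law is \<open>p D v\<close>
  itself.\<close>

lemma cond_var_eq:
  assumes "v \<in> M" "w D v > 0"
  shows "cond_var K L w p D K v = s v - (m v)\<^sup>2"
proof -
  interpret real_distribution "p D v" using distributions assms by blast
  have "Y_conditional K L w p D K v = p D v"
    using finite_levels distributions assms by (rule Y_conditional_full)
  then show ?thesis
    using variance_eq[OF integrable_p[OF assms] square_integrable_p[OF assms]]
    by (simp add: cond_var_def s_def m_def)
qed

lemma stacking_variance_eq:
  "stacking_variance K L w p D = (\<Sum>v\<in>M. w D v * s v) - (\<Sum>v\<in>M. w D v * m v)\<^sup>2"
proof -
  let ?P = "stacking_predictive K L w p D"
  note mix = integral_mixture[where M = borel and N = ?P and S = M and p = "p D" and a = "w D"]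
  have P: "emeasure ?P A = (\<Sum>v\<in>M. ennreal (w D v) * emeasure (p D v) A)" if "A \<in> sets borel" for A
    using distributions that by (rule emeasure_stacking_predictive)
  have mean: "integrable ?P (\<lambda>y. y)" "(\<integral>y. y \<partial>?P) = (\<Sum>v\<in>M. w D v * m v)"
    unfolding m_def by (rule mix; simp add: sets_p P w_nonneg integrable_p)+
  have square: "(\<integral>y. y\<^sup>2 \<partial>?P) = (\<Sum>v\<in>M. w D v * s v)"
    unfolding s_def by (rule mix(2); simp add: sets_p P w_nonneg square_integrable_p)
  interpret prob_space ?P
  proof
    have "space ?P = UNIV" by (simp add: stacking_predictive_def space_measure_of_conv)
    moreover have "emeasure (p D v) UNIV = 1" if "v \<in> M" for v
    proof -
      interpret real_distribution "p D v" using distributions that by blast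
      show ?thesis using emeasure_space_1 by simp
    qed
    ultimately show "emeasure ?P (space ?P) = 1"
      by (simp add: P w_nonneg sum_w)
  qed
  show ?thesis
    unfolding stacking_variance_def using variance_eq[OF mean(1) square_integrable]
    by (simp add: mean square)
qed

section \<open>The laws of V as finite sums\<close>

lemma set_V_pmf: "set_pmf (V_pmf K L w D) \<subseteq> M"
  by (auto simp: set_pmf_eq pmf_V_pmf[OF finite_levels weights] split: if_splits)

text \<open>Averages over prefixes are pulled back to complete models, so that the terms for
  different \<open>k\<close> become sums over the same set \<open>M\<close> and can cancel.\<close>

lemma expectation_V_marginal:
  fixes f :: "(nat \<Rightarrow> 'v) \<Rightarrow> real"
  shows "measure_pmf.expectation (V_marginal K L w D k) f = (\<Sum>v\<in>M. w D v * f (initial k v))"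
proof -
  have "measure_pmf.expectation (V_marginal K L w D k) f =
      measure_pmf.expectation (V_pmf K L w D) (\<lambda>v. f (initial k v))"
    by (simp add: V_marginal_def)
  also have "\<dots> = (\<Sum>v\<in>M. f (initial k v) * pmf (V_pmf K L w D) v)"
    using set_V_pmf by (intro integral_measure_pmf_real finite_M) blast
  finally show ?thesis
    by (simp add: pmf_V_pmf[OF finite_levels weights] mult.commute)
qed

lemma finite_V_marginal: "finite (set_pmf (V_marginal K L w D k))"
  using finite_subset[OF set_V_pmf finite_M] by (simp add: V_marginal_def)

lemma V_conditional:
  fixes f :: "'v \<Rightarrow> real"
  assumes v: "v \<in> M" "w D v > 0"
  shows "measure_pmf.expectation (V_conditional K L w D k (initial (k - 1) v)) f =
      fibre_mean (w D) M (initial (k - 1)) (\<lambda>v. f (v k)) (initial (k - 1) v)"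
    and "finite (set_pmf (V_conditional K L w D k (initial (k - 1) v)))"
proof -
  let ?V = "V_pmf K L w D" and ?u = "initial (k - 1) v"
  let ?E = "{v. initial (k - 1) v = ?u}" and ?S = "{v. v \<in> M \<and> initial (k - 1) v = ?u}"
  have "v \<in> set_pmf ?V" using v by (simp add: set_pmf_iff pmf_V_pmf[OF finite_levels weights])
  \<comment> \<open>The model \<open>v\<close> itself witnesses that the conditioning event has
    positive probability, without which \<open>cond_pmf\<close> is unspecified.\<close>
  then have ne: "set_pmf ?V \<inter> ?E \<noteq> {}" by blast
  have fin: "finite ?S" using finite_M by simp
  have S: "set_pmf (cond_pmf ?V ?E) \<subseteq> ?S" using set_cond_pmf[OF ne] set_V_pmf by blast
  show "finite (set_pmf (V_conditional K L w D k ?u))"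
    using finite_subset[OF S fin] by (simp add: V_conditional_def)
  have prob: "measure_pmf.prob ?V ?E = (\<Sum>v\<in>?S. w D v)"
  proof -
    have "measure_pmf.prob ?V ?E = measure_pmf.prob ?V ?S"
      using set_V_pmf by (intro measure_prob_cong_0) (auto simp: set_pmf_iff)
    then show ?thesis
      using fin by (simp add: measure_measure_pmf_finite pmf_V_pmf[OF finite_levels weights])
  qed
  have "measure_pmf.expectation (V_conditional K L w D k ?u) f =
      measure_pmf.expectation (cond_pmf ?V ?E) (\<lambda>v. f (v k))"
    by (simp add: V_conditional_def)
  also have "\<dots> = (\<Sum>v\<in>?S. f (v k) * pmf (cond_pmf ?V ?E) v)"
    using S by (intro integral_measure_pmf_real fin) blast
  also have "\<dots> = (\<Sum>v\<in>?S. w D v * f (v k) / (\<Sum>v\<in>?S. w D v))"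
    by (intro sum.cong refl)
      (simp add: pmf_cond[OF ne] prob pmf_V_pmf[OF finite_levels weights] mult.commute)
  finally show "measure_pmf.expectation (V_conditional K L w D k ?u) f =
      fibre_mean (w D) M (initial (k - 1)) (\<lambda>v. f (v k)) ?u"
    by (simp add: fibre_mean_def sum_divide_distrib)
qed

section \<open>Second moments of the successive conditional means\<close>

definition \<mu> :: "nat \<Rightarrow> (nat \<Rightarrow> 'v) \<Rightarrow> real" where
  "\<mu> k v = fibre_mean (w D) M (initial k) m (initial k v)"

text \<open>Conditional quantities are identified only at models of positive weight. Under a
  weighted sum this suffices to replace \<open>cond_mean\<close> by \<mu>, whatever values the two
  take elsewhere.\<close>

lemma weighted_sum_cong:
  assumes "\<And>v. v \<in> M \<Longrightarrow> w D v > 0 \<Longrightarrow> f v = g v"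
  shows "(\<Sum>v\<in>M. w D v * f v) = (\<Sum>v\<in>M. w D v * g v)"
  using assms w_nonneg by (intro sum.cong refl) (metis less_eq_real_def mult_zero_left)

text \<open>All \<mu> have the same mean, whatever \<open>k\<close>; hence the squared mean
  subtracted in \<open>var_cond_mean\<close> is the same for every \<open>k\<close>.\<close>

lemma sum_\<mu>: "(\<Sum>v\<in>M. w D v * \<mu> k v) = (\<Sum>v\<in>M. w D v * m v)"
  using sum_fibre_mean[where w = "w D", OF finite_M w_nonneg, where g = "\<lambda>_. 1" and r = "initial k" and h = m]
  by (simp add: \<mu>_def)

lemma \<mu>_full:
  assumes "v \<in> M" "w D v > 0"
  shows "\<mu> K v = m v"
proof -
  have "{v'. v' \<in> M \<and> initial K v' = initial K v} = {v}"
    using assms(1) initial_models by auto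
  then show ?thesis using assms by (simp add: \<mu>_def fibre_mean_def)
qed

text \<open>Written with \<open>\<mu> K\<close> in place of \<open>m\<close> so that its last sum
  cancels the first sum of \<open>var_cond_mean_eq\<close> at \<open>k = K\<close>.\<close>

lemma mean_cond_var_eq:
  "mean_cond_var K L w p D K = (\<Sum>v\<in>M. w D v * s v) - (\<Sum>v\<in>M. w D v * (\<mu> K v)\<^sup>2)"
proof -
  have "mean_cond_var K L w p D K = (\<Sum>v\<in>M. w D v * (s v - (\<mu> K v)\<^sup>2))"
    unfolding mean_cond_var_def expectation_V_marginal
    by (rule weighted_sum_cong) (simp add: initial_models cond_var_eq \<mu>_full)
  then show ?thesis by (simp add: right_diff_distrib sum_subtractf)
qed

lemma var_cond_mean_eq:
  "var_cond_mean K L w p D k = (\<Sum>v\<in>M. w D v * (\<mu> k v)\<^sup>2) - (\<Sum>v\<in>M. w D v * m v)\<^sup>2"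
proof -
  have "var_cond_mean K L w p D k =
      (\<Sum>v\<in>M. w D v * (cond_mean K L w p D k (initial k v))\<^sup>2) -
      (\<Sum>v\<in>M. w D v * cond_mean K L w p D k (initial k v))\<^sup>2"
    unfolding var_cond_mean_def
    by (subst measure_pmf.variance_eq)
      (simp_all add: integrable_measure_pmf_finite finite_V_marginal expectation_V_marginal)
  moreover have "(\<Sum>v\<in>M. w D v * (cond_mean K L w p D k (initial k v))\<^sup>2) =
      (\<Sum>v\<in>M. w D v * (\<mu> k v)\<^sup>2)"
    by (rule weighted_sum_cong) (simp add: cond_mean_eq \<mu>_def)
  moreover have "(\<Sum>v\<in>M. w D v * cond_mean K L w p D k (initial k v)) = (\<Sum>v\<in>M. w D v * \<mu> k v)"
    by (rule weighted_sum_cong) (simp add: cond_mean_eq \<mu>_def)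
  ultimately show ?thesis by (simp add: sum_\<mu>)
qed

text \<open>Given the first \<open>k - 1\<close> factors, \<open>\<mu> k\<close> has mean
  \<open>\<mu> (k - 1)\<close> by the tower property. Its conditional variance is therefore the
  conditional mean of its square minus the square of \<open>\<mu> (k - 1)\<close>; averaging removes
  the conditioning.\<close>

lemma mean_var_cond_mean_eq:
  assumes "k \<ge> 1"
  shows "mean_var_cond_mean K L w p D k =
    (\<Sum>v\<in>M. w D v * (\<mu> k v)\<^sup>2) - (\<Sum>v\<in>M. w D v * (\<mu> (k - 1) v)\<^sup>2)"
proof -
  let ?q = "initial (k - 1)"
  have "measure_pmf.variance (V_conditional K L w D k (?q v))
        (\<lambda>x. cond_mean K L w p D k ((?q v)(k := x))) =
      fibre_mean (w D) M ?q (\<lambda>v. (\<mu> k v)\<^sup>2) (?q v) - (\<mu> (k - 1) v)\<^sup>2"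
    if v: "v \<in> M" "w D v > 0" for v
  proof -
    \<comment> \<open>Here \<open>k \<ge> 1\<close> matters: it makes \<open>{1..k}\<close> the set
      \<open>{1..k-1}\<close> with \<open>k\<close> added.\<close>
    have upd: "(?q v)(k := v' k) = initial k v'" if "?q v' = ?q v" for v'
      unfolding that[symmetric] using assms by (auto simp: restrict_def fun_eq_iff)
    \<comment> \<open>Used with the identity and the square, for the first and second conditional
      moments. Models \<open>v'\<close> of weight zero, where \<open>cond_mean\<close> is not
      identified, drop out of the fibre mean.\<close>
    have fm: "fibre_mean (w D) M ?q (\<lambda>v'. f (cond_mean K L w p D k ((?q v)(k := v' k)))) (?q v) =
        fibre_mean (w D) M ?q (\<lambda>v'. f (\<mu> k v')) (?q v)" for f :: "real \<Rightarrow> real"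
    proof -
      have "w D v' * f (cond_mean K L w p D k ((?q v)(k := v' k))) = w D v' * f (\<mu> k v')"
        if "v' \<in> M" "?q v' = ?q v" for v'
        using that w_nonneg[of v'] by (cases "w D v' = 0") (auto simp: upd cond_mean_eq \<mu>_def)
      then show ?thesis unfolding fibre_mean_def by (intro arg_cong2[where f = "(/)"] sum.cong) auto
    qed
    have tower: "fibre_mean (w D) M ?q (\<mu> k) (?q v) = \<mu> (k - 1) v"
    proof -
      have "?q x = ?q y" if "initial k x = initial k y" for x y :: "nat \<Rightarrow> 'v"
      proof -
        have "?q z = initial (k - 1) (initial k z)" for z :: "nat \<Rightarrow> 'v"
          by (auto simp: fun_eq_iff restrict_def)
        then show ?thesis using that by metis
      qed
      then show ?thesis
        using fibre_mean_tower[where w = "w D", OF finite_M w_nonneg, where q = ?q and r = "initial k" and h = m]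
        unfolding \<mu>_def by blast
    qed
    show ?thesis
      using fm[of "\<lambda>x. x"] fm[of "\<lambda>x. x\<^sup>2"] tower
      by (subst measure_pmf.variance_eq)
        (simp_all add: integrable_measure_pmf_finite V_conditional[OF v])
  qed
  then have "mean_var_cond_mean K L w p D k =
      (\<Sum>v\<in>M. w D v * (fibre_mean (w D) M ?q (\<lambda>v. (\<mu> k v)\<^sup>2) (?q v) - (\<mu> (k - 1) v)\<^sup>2))"
    unfolding mean_var_cond_mean_def expectation_V_marginal by (rule weighted_sum_cong)
  also have "\<dots> = (\<Sum>v\<in>M. w D v * (\<mu> k v)\<^sup>2) - (\<Sum>v\<in>M. w D v * (\<mu> (k - 1) v)\<^sup>2)"
    using sum_fibre_mean[where w = "w D", OF finite_M w_nonneg, where g = "\<lambda>_. 1" and r = ?q and h = "\<lambda>v. (\<mu> k v)\<^sup>2"]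
    by (simp add: right_diff_distrib sum_subtractf)
  finally show ?thesis .
qed

text \<open>Telescoping. The induction starts at \<open>n = 1\<close>, where the sum is empty and
  both terms on the right agree.\<close>

lemma sum_mean_var_cond_mean:
  assumes "n \<ge> 1"
  shows "(\<Sum>k=2..n. mean_var_cond_mean K L w p D k) =
    (\<Sum>v\<in>M. w D v * (\<mu> n v)\<^sup>2) - (\<Sum>v\<in>M. w D v * (\<mu> 1 v)\<^sup>2)"
  using assms by (induction n rule: dec_induct) (simp_all add: mean_var_cond_mean_eq)

end

theorem proposition3p2:
  fixes K :: nat
    and L :: "nat \<Rightarrow> 'v set"
    and w :: "'d \<Rightarrow> (nat \<Rightarrow> 'v) \<Rightarrow> real"
    and p :: "'d \<Rightarrow> (nat \<Rightarrow> 'v) \<Rightarrow> real measure"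
    and D :: 'd
  assumes "K \<ge> 1"
    and "\<forall>k\<in>{1..K}. finite (L k)"
    and "stacking_weights K L w D"
    and "\<forall>v\<in>models K L. real_distribution (p D v)"
    and "integrable (stacking_predictive K L w p D) (\<lambda>y. y\<^sup>2)"
  shows "(K = 1 \<longrightarrow>
            stacking_variance K L w p D = mean_cond_var K L w p D 1 + var_cond_mean K L w p D 1) \<and>
         (K \<ge> 2 \<longrightarrow>
            stacking_variance K L w p D =
              mean_cond_var K L w p D K
              + (\<Sum>k=2..K. mean_var_cond_mean K L w p D k)
              + var_cond_mean K L w p D 1) \<and>
         stacking_variance K L w p D = mean_cond_var K L w p D K + var_cond_mean K L w p D K"
proof -
  interpret stacking K L w p D
    using assms by unfold_locales
  have "stacking_variance K L w p D = mean_cond_var K L w p D K + var_cond_mean K L w p D K"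
    by (simp add: stacking_variance_eq mean_cond_var_eq var_cond_mean_eq)
  \<comment> \<open>This splits the second term of (ii) into the remaining terms of (i). For
    \<open>K = 1\<close> the identity (ii) is already the claim.\<close>
  moreover have "var_cond_mean K L w p D K =
      (\<Sum>k=2..K. mean_var_cond_mean K L w p D k) + var_cond_mean K L w p D 1"
    using sum_mean_var_cond_mean[OF \<open>K \<ge> 1\<close>] by (simp add: var_cond_mean_eq)
  ultimately show ?thesis by auto
qed

end
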